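(* Let $G$ be a finite group. Then the power graph $\mathcal P_G$ is isomorphic to the generalized lexicographic product $\mathcal I_G[\mathbb K_G]$.
   Context: The power graph $\mathcal P_G$ has vertex set $G$, two distinct elements adjacent iff one is a power of the other. Let $\mathcal C(G)$ be the set of cyclic subgroups of $G$. $\mathcal I_G$ is the graph on $\mathcal C(G)$ in which two distinct cyclic subgroups are adjacent iff one contains the other. For $C\in\mathcal C(G)$, $\mathcal K_C$ is the complete graph on $\varphi(|C|)$ vertices ($\varphi$ Euler's totient), and $\mathbb K_G=\{\mathcal K_C: C\in\mathcal C(G)\}$. For a graph $\mathcal H$ and a family $\{\mathcal F_v: v\in V(\mathcal H)\}$ of graphs, the generalized lexicographic product $\mathcal H[\{\mathcal F_v\}]$ has vertex set $\{(v,w): v\in V(\mathcal H), w\in V(\mathcal F_v)\}$, and $(v_1,w_1),(v_2,w_2)$ are adjacent iff $\{v_1,v_2\}\in E(\mathcal H)$, or $v_1=v_2$ and $\{w_1,w_2\}\in E(\mathcal F_{v_1})$. *)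

theory Defs
  imports
    "HOL-Algebra.Elementary_Groups"
    "HOL-Number_Theory.Totient"
    "Graph_Theory.Graph_Theory"
begin

text \<open>
  A simple graph is a symmetric loop-free \<^type>\<open>pair_pre_digraph\<close>: the edge \<open>{u, v}\<close> is
  represented by the two arcs \<open>(u, v)\<close> and \<open>(v, u)\<close>. On such graphs \<^const>\<open>digraph_iso\<close> is
  isomorphism of simple graphs. The \<open>pair_graph\<close> lemmas below confirm that every graph
  constructed here is of this form.
\<close>

definition power_graph :: "('a, 'b) monoid_scheme \<Rightarrow> 'a pair_pre_digraph" where
  "power_graph G = \<lparr>
     pverts = carrier G,
     parcs = {(x, y). x \<in> carrier G \<and> y \<in> carrier G \<and> x \<noteq> y \<and>
                ((\<exists>n::nat. x = y [^]\<^bsub>G\<^esub> n) \<or> (\<exists>n::nat. y = x [^]\<^bsub>G\<^esub> n))} \<rparr>"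

definition cyclic_subgroups :: "('a, 'b) monoid_scheme \<Rightarrow> 'a set set" where
  "cyclic_subgroups G = {C. subgroup C G \<and> cyclic_group (G\<lparr>carrier := C\<rparr>)}"

definition inclusion_graph :: "('a, 'b) monoid_scheme \<Rightarrow> 'a set pair_pre_digraph" where
  "inclusion_graph G = \<lparr>
     pverts = cyclic_subgroups G,
     parcs = {(C, D). C \<in> cyclic_subgroups G \<and> D \<in> cyclic_subgroups G \<and> C \<noteq> D \<and>
                (C \<subseteq> D \<or> D \<subseteq> C)} \<rparr>"

definition complete_graph :: "nat \<Rightarrow> nat pair_pre_digraph" where
  "complete_graph n = \<lparr>
     pverts = {..<n},
     parcs = {(i, j). i < n \<and> j < n \<and> i \<noteq> j} \<rparr>"

definition cyclic_complete_family :: "'a set \<Rightarrow> nat pair_pre_digraph" where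
  "cyclic_complete_family C = complete_graph (totient (card C))"

definition gen_lex_product ::
  "'v pair_pre_digraph \<Rightarrow> ('v \<Rightarrow> 'w pair_pre_digraph) \<Rightarrow> ('v \<times> 'w) pair_pre_digraph" where
  "gen_lex_product H F = \<lparr>
     pverts = (SIGMA v : pverts H. pverts (F v)),
     parcs = {((v1, w1), (v2, w2)).
                (v1, w1) \<in> (SIGMA v : pverts H. pverts (F v)) \<and>
                (v2, w2) \<in> (SIGMA v : pverts H. pverts (F v)) \<and>
                ((v1, v2) \<in> parcs H \<or> v1 = v2 \<and> (w1, w2) \<in> parcs (F v1))} \<rparr>"

lemma pair_graphI:
  assumes "finite (pverts P)"
    and "\<And>u v. (u, v) \<in> parcs P \<Longrightarrow> u \<in> pverts P \<and> v \<in> pverts P \<and> u \<noteq> v \<and> (v, u) \<in> parcs P"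
  shows "pair_graph P"
proof -
  have "parcs P \<subseteq> pverts P \<times> pverts P"
    using assms(2) by auto
  then have "finite (parcs P)"
    using assms(1) finite_subset by blast
  moreover have "symmetric (with_proj P)"
    unfolding symmetric_def arcs_ends_def arc_to_ends_def
    using assms(2) by (auto intro!: symI)
  ultimately show ?thesis
    using assms by unfold_locales auto
qed

lemma pair_graphD:
  assumes "pair_graph P" and "(u, v) \<in> parcs P"
  shows "u \<in> pverts P" "v \<in> pverts P" "u \<noteq> v" "(v, u) \<in> parcs P"
proof -
  interpret pair_graph P by fact
  show "u \<in> pverts P" "v \<in> pverts P" "u \<noteq> v" "(v, u) \<in> parcs P"
    using assms(2) in_arcsD1 in_arcsD2 no_loops' arcs_symmetric by blast+
qed

lemma pair_graph_finite: "pair_graph P \<Longrightarrow> finite (pverts P)"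
  by (simp add: pair_graph_def pair_digraph_def pair_fin_digraph_def pair_fin_digraph_axioms_def)

lemma pair_graph_power_graph:
  "finite (carrier G) \<Longrightarrow> pair_graph (power_graph G)"
  by (rule pair_graphI) (auto simp: power_graph_def)

lemma finite_cyclic_subgroups:
  assumes "finite (carrier G)" shows "finite (cyclic_subgroups G)"
proof (rule finite_subset)
  show "cyclic_subgroups G \<subseteq> Pow (carrier G)"
    by (auto simp: cyclic_subgroups_def dest: subgroup.subset)
qed (use assms in simp)

lemma pair_graph_inclusion_graph:
  "finite (carrier G) \<Longrightarrow> pair_graph (inclusion_graph G)"
  by (rule pair_graphI) (auto simp: inclusion_graph_def finite_cyclic_subgroups)

lemma pair_graph_complete_graph: "pair_graph (complete_graph n)"
  by (rule pair_graphI) (auto simp: complete_graph_def)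

lemma complete_digraph_complete_graph: "complete_digraph n (with_proj (complete_graph n))"
  unfolding complete_digraph_pair_def by (auto simp: complete_graph_def)

lemma pair_graph_gen_lex_product:
  assumes "pair_graph H" and "\<And>v. v \<in> pverts H \<Longrightarrow> pair_graph (F v)"
  shows "pair_graph (gen_lex_product H F)"
proof (rule pair_graphI)
  show "finite (pverts (gen_lex_product H F))"
    using assms by (simp add: gen_lex_product_def pair_graph_finite)
next
  fix a b assume ab: "(a, b) \<in> parcs (gen_lex_product H F)"
  obtain v1 w1 v2 w2 where [simp]: "a = (v1, w1)" "b = (v2, w2)"
    by (cases a, cases b)
  have V: "v1 \<in> pverts H" "w1 \<in> pverts (F v1)" "v2 \<in> pverts H" "w2 \<in> pverts (F v2)"
    and E: "(v1, v2) \<in> parcs H \<or> v1 = v2 \<and> (w1, w2) \<in> parcs (F v1)"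
    using ab by (simp_all add: gen_lex_product_def)
  from E show "a \<in> pverts (gen_lex_product H F) \<and> b \<in> pverts (gen_lex_product H F) \<and> a \<noteq> b
      \<and> (b, a) \<in> parcs (gen_lex_product H F)"
  proof (elim disjE conjE)
    assume "(v1, v2) \<in> parcs H"
    from pair_graphD(3,4)[OF assms(1) this] V show ?thesis
      by (simp add: gen_lex_product_def)
  next
    assume "v1 = v2" "(w1, w2) \<in> parcs (F v1)"
    with pair_graphD(3,4)[OF assms(2)[OF V(1)] this(2)] V show ?thesis
      by (simp add: gen_lex_product_def)
  qed
qed

end

theory Submission
  imports Defs "HOL-Algebra.Multiplicative_Group"
begin

text \<open>
  Two elements of a finite group that generate the same cyclic subgroup are powers of each other,
  and in general one element is a power of another iff the subgroups they generate are nested.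
  Hence adjacency in the power graph of distinct \<open>x\<close>, \<open>y\<close> depends only on \<open>\<langle>x\<rangle>\<close> and \<open>\<langle>y\<rangle>\<close>.
  Since a cyclic group of order \<open>n\<close> has \<open>\<phi>(n)\<close> generators, numbering the generators of each cyclic
  subgroup \<open>C\<close> by \<open>h\<^sub>C\<close> makes \<open>x \<mapsto> (\<langle>x\<rangle>, h\<^bsub>\<langle>x\<rangle>\<^esub> x)\<close> an isomorphism.
\<close>

text \<open>An arc of a pair digraph is its pair of endpoints, so \<open>f\<close> forces the arc
  map to be \<open>map_prod f f\<close>. By \<open>wf_Q\<close> both ends of an arc of
  \<open>Q\<close> lie in the image of \<open>f\<close>, which makes this map onto the arcs of
  \<open>Q\<close>.\<close>

lemma digraph_iso_with_projI:
  assumes "wf_digraph (with_proj P)"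
    and wf_Q: "parcs Q \<subseteq> pverts Q \<times> pverts Q"
    and bij: "bij_betw f (pverts P) (pverts Q)"
    and arcs: "\<And>x y. x \<in> pverts P \<Longrightarrow> y \<in> pverts P \<Longrightarrow>
      (x, y) \<in> parcs P \<longleftrightarrow> (f x, f y) \<in> parcs Q"
  shows "digraph_iso (with_proj P) (with_proj Q)"
proof -
  interpret wf_digraph "with_proj P" by fact
  have inj: "inj_on f (pverts P)" and img: "f ` pverts P = pverts Q"
    using bij by (auto simp: bij_betw_def)
  have wf_P: "parcs P \<subseteq> pverts P \<times> pverts P"
    using tail_in_verts head_in_verts by fastforce
  have inj_arcs: "inj_on (map_prod f f) (parcs P)"
    using map_prod_inj_on[OF inj inj] wf_P by (rule inj_on_subset)
  have "map_prod f f ` parcs P = parcs Q"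
  proof
    show "map_prod f f ` parcs P \<subseteq> parcs Q"
      using wf_P arcs by auto
    show "parcs Q \<subseteq> map_prod f f ` parcs P"
    proof clarify
      fix u v assume uv: "(u, v) \<in> parcs Q"
      then obtain x y where "x \<in> pverts P" "y \<in> pverts P" "u = f x" "v = f y"
        using wf_Q img by blast
      with uv arcs show "(u, v) \<in> map_prod f f ` parcs P"
        by (force intro!: image_eqI[of _ _ "(x, y)"])
    qed
  qed
  then have "with_proj Q =
      app_iso \<lparr>iso_verts = f, iso_arcs = map_prod f f, iso_head = snd, iso_tail = fst\<rparr> (with_proj P)"
    by (simp add: app_iso_def with_proj_def img)
  moreover have "digraph_isomorphism
      \<lparr>iso_verts = f, iso_arcs = map_prod f f, iso_head = snd, iso_tail = fst\<rparr>"
    unfolding digraph_isomorphism_def using inj inj_arcs wf_digraph_axioms by simp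
  ultimately show ?thesis
    unfolding digraph_iso_def by blast
qed

context group
begin

lemma generate_singleton_subset_iff:
  assumes "x \<in> carrier G" "y \<in> carrier G"
  shows "generate G {x} \<subseteq> generate G {y} \<longleftrightarrow> x \<in> generate G {y}"
proof
  show "x \<in> generate G {y}" if "generate G {x} \<subseteq> generate G {y}"
    using that generate.incl[of x "{x}" G] by auto
  show "generate G {x} \<subseteq> generate G {y}" if "x \<in> generate G {y}"
    using that assms by (intro generate_subgroup_incl generate_is_subgroup) auto
qed

text \<open>In a finite group inverses are natural powers, so the natural powers of \<open>y\<close>
  already exhaust \<open>generate G {y}\<close>. This turns adjacency in the power graph into
  nesting of cyclic subgroups.\<close>

lemma ex_nat_pow_iff_generate_subset:
  assumes "finite (carrier G)" "x \<in> carrier G" "y \<in> carrier G"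
  shows "(\<exists>n::nat. x = y [^] n) \<longleftrightarrow> generate G {x} \<subseteq> generate G {y}"
proof -
  have "(\<exists>n::nat. x = y [^] n) \<longleftrightarrow> x \<in> generate G {y}"
    unfolding generate_pow_on_finite_carrier[OF assms(1,3)] by simp
  then show ?thesis
    using generate_singleton_subset_iff[OF assms(2,3)] by simp
qed

lemma cyclic_subgroups_eq_image_generate:
  "cyclic_subgroups G = (\<lambda>x. generate G {x}) ` carrier G"
proof (intro equalityI subsetI)
  fix C assume "C \<in> cyclic_subgroups G"
  then have sub: "subgroup C G" and cyc: "cyclic_group (G\<lparr>carrier := C\<rparr>)"
    by (auto simp: cyclic_subgroups_def)
  from cyc obtain x where x: "x \<in> C"
    and eq: "subgroup_generated (G\<lparr>carrier := C\<rparr>) {x} = G\<lparr>carrier := C\<rparr>"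
    by (auto simp: cyclic_group_def)
  \<comment> \<open>The carriers of the two records in \<open>eq\<close> are compared; the generator
    is then moved from the restricted group to \<open>G\<close>.\<close>
  have "C = generate (G\<lparr>carrier := C\<rparr>) {x}"
    using arg_cong[OF eq, of carrier] x by (simp add: carrier_subgroup_generated)
  then have "C = generate G {x}"
    using generate_consistent[of "{x}" C] sub x by simp
  then show "C \<in> (\<lambda>x. generate G {x}) ` carrier G"
    using x sub subgroup.mem_carrier by fast
next
  fix C assume "C \<in> (\<lambda>x. generate G {x}) ` carrier G"
  then obtain x where x: "x \<in> carrier G" and C: "C = generate G {x}" by auto
  have "subgroup_generated G {x} = G\<lparr>carrier := C\<rparr>"
    using x by (simp add: subgroup_generated_def C)
  then show "C \<in> cyclic_subgroups G"
    using cyclic_group_generated[of x] generate_is_subgroup[of "{x}"] x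
    by (simp add: cyclic_subgroups_def C)
qed

text \<open>Every generator is a power of \<open>a\<close>, and a power of \<open>a\<close> has the
  order of \<open>a\<close> iff its exponent is coprime to \<open>ord a\<close>. Conversely, nested
  finite subgroups of equal size coincide.\<close>

lemma generators_eq_image_totatives:
  assumes fin: "finite (carrier G)" and a: "a \<in> carrier G"
  shows "{x \<in> carrier G. generate G {x} = generate G {a}} = (\<lambda>k. a [^] k) ` totatives (ord a)"
proof (intro equalityI subsetI)
  fix x assume "x \<in> {x \<in> carrier G. generate G {x} = generate G {a}}"
  then have x: "x \<in> carrier G" and eq: "generate G {x} = generate G {a}" by auto
  obtain n :: nat where n: "x = a [^] n"
    using ex_nat_pow_iff_generate_subset[OF fin x a] eq by auto
  have "ord x = ord a"
    using generate_pow_card x a eq by simp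
  then have cop: "coprime n (ord a)"
    using pow_ord_eq_ord_iff[OF fin a] n by simp
  have pos: "ord a > 0" using ord_ge_1[OF fin a] by simp
  show "x \<in> (\<lambda>k. a [^] k) ` totatives (ord a)"
  \<comment> \<open>The residue of \<open>n\<close> modulo \<open>ord a\<close> serves as exponent,
    but totatives are positive: for \<open>ord a = 1\<close> the residue is 0 while the only
    totative is 1. Otherwise coprimality excludes the residue 0.\<close>
  proof (cases "ord a = 1")
    case True
    then have "a = \<one>" using ord_eq_1[OF a] by simp
    then show ?thesis by (simp add: n)
  next
    case False
    have "n mod ord a \<in> totatives (ord a)"
      using cop pos False by (auto simp: in_totatives_iff intro!: Nat.gr0I)
    moreover have "x = (a [^] ord a) [^] (n div ord a) \<otimes> a [^] (n mod ord a)"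
      unfolding n nat_pow_pow[OF a] nat_pow_mult[OF a] by simp
    then have "x = a [^] (n mod ord a)"
      using a by simp
    ultimately show ?thesis by blast
  qed
next
  fix x assume "x \<in> (\<lambda>k. a [^] k) ` totatives (ord a)"
  then obtain k where k: "coprime k (ord a)" and xk: "x = a [^] k"
    by (auto simp: in_totatives_iff)
  have x: "x \<in> carrier G" using a xk by simp
  have "generate G {x} \<subseteq> generate G {a}"
    using ex_nat_pow_iff_generate_subset[OF fin x a] xk by auto
  moreover have "card (generate G {x}) = card (generate G {a})"
    using pow_ord_eq_ord_iff[OF fin a] k xk generate_pow_card x a by simp
  moreover have "finite (generate G {a})"
    using fin a generate_incl[of "{a}"] by (auto intro: finite_subset)
  ultimately show "x \<in> {x \<in> carrier G. generate G {x} = generate G {a}}"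
    using x card_subset_eq by blast
qed

lemma card_generators:
  assumes "finite (carrier G)" "a \<in> carrier G"
  shows "card {x \<in> carrier G. generate G {x} = generate G {a}} = totient (ord a)"
proof -
  \<comment> \<open>Totatives range over 1 to \<open>ord a\<close>, not over 0 to
    \<open>ord a - 1\<close>; \<open>ord_inj'\<close> is the injectivity statement for that
    range.\<close>
  have "inj_on (\<lambda>k. a [^] k) (totatives (ord a))"
    using ord_inj'[OF assms(2)] by (rule inj_on_subset) (auto simp: in_totatives_iff)
  then show ?thesis
    by (simp add: generators_eq_image_totatives[OF assms] card_image totient_def)
qed

end

theorem theorem2p17:
  fixes G :: "('a, 'b) monoid_scheme"
  assumes "group G" and "finite (carrier G)"
  shows "digraph_iso (with_proj (power_graph G))
           (with_proj (gen_lex_product (inclusion_graph G) cyclic_complete_family))"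
proof -
  interpret group G by fact
  let ?Q = "gen_lex_product (inclusion_graph G) cyclic_complete_family"
  define gens where "gens C = {x \<in> carrier G. generate G {x} = C}" for C
  have "\<exists>h. bij_betw h (gens C) {..<totient (card C)}" if "C \<in> cyclic_subgroups G" for C
  proof -
    obtain a where "a \<in> carrier G" "C = generate G {a}"
      using \<open>C \<in> cyclic_subgroups G\<close> by (auto simp: cyclic_subgroups_eq_image_generate)
    then have "card (gens C) = totient (card C)"
      using card_generators[OF assms(2)] generate_pow_card by (simp add: gens_def)
    moreover have "finite (gens C)"
      using assms(2) by (simp add: gens_def)
    ultimately show ?thesis
      using ex_bij_betw_finite_nat atLeast0LessThan by metis
  qed
  then obtain h where h: "\<And>C. C \<in> cyclic_subgroups G \<Longrightarrow> bij_betw (h C) (gens C) {..<totient (card C)}"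
    by metis
  define f where "f x = (generate G {x}, h (generate G {x}) x)" for x
  have vertsQ: "pverts ?Q = (SIGMA C : cyclic_subgroups G. {..<totient (card C)})"
    by (simp add: gen_lex_product_def inclusion_graph_def cyclic_complete_family_def
        complete_graph_def)
  have inj: "inj_on f (carrier G)"
  proof (rule inj_onI)
    fix x y assume x: "x \<in> carrier G" and y: "y \<in> carrier G" and eq: "f x = f y"
    let ?C = "generate G {x}"
    \<comment> \<open>Equal first components put \<open>x\<close> and \<open>y\<close> into the same
      class \<open>gens ?C\<close>, on which the numbering \<open>h ?C\<close> is injective.\<close>
    have "?C \<in> cyclic_subgroups G"
      using x by (simp add: cyclic_subgroups_eq_image_generate)
    moreover have "x \<in> gens ?C" "y \<in> gens ?C" "h ?C x = h ?C y"
      using x y eq by (auto simp: gens_def f_def)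
    ultimately show "x = y"
      using h bij_betw_imp_inj_on inj_onD by metis
  qed
  have img: "f ` carrier G = pverts ?Q"
  proof (intro equalityI subsetI)
    fix p assume "p \<in> f ` carrier G"
    then obtain x where x: "x \<in> carrier G" and p: "p = f x" by auto
    have "generate G {x} \<in> cyclic_subgroups G" "x \<in> gens (generate G {x})"
      using x by (auto simp: cyclic_subgroups_eq_image_generate gens_def)
    then show "p \<in> pverts ?Q"
      using h bij_betwE unfolding vertsQ p f_def by blast
  next
    fix p assume "p \<in> pverts ?Q"
    then obtain C i where p: "p = (C, i)" and C: "C \<in> cyclic_subgroups G"
      and i: "i \<in> {..<totient (card C)}"
      unfolding vertsQ by blast
    \<comment> \<open>The preimage of \<open>(C, i)\<close> is the generator of \<open>C\<close>
      with number \<open>i\<close>; membership in \<open>gens C\<close> makes the first component of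
      \<open>f x\<close> equal to \<open>C\<close>.\<close>
    obtain x where "x \<in> gens C" "h C x = i"
      using h[OF C] i unfolding bij_betw_def by (metis imageE)
    then show "p \<in> f ` carrier G"
      by (auto simp: p f_def gens_def)
  qed
  show ?thesis
  proof (rule digraph_iso_with_projI)
    show "wf_digraph (with_proj (power_graph G))"
      by unfold_locales (auto simp: power_graph_def)
    show "parcs ?Q \<subseteq> pverts ?Q \<times> pverts ?Q"
      by (auto simp: gen_lex_product_def)
    show "bij_betw f (pverts (power_graph G)) (pverts ?Q)"
      using inj img by (simp add: bij_betw_def power_graph_def)
  next
    fix x y assume "x \<in> pverts (power_graph G)" "y \<in> pverts (power_graph G)"
    then have x: "x \<in> carrier G" and y: "y \<in> carrier G" by (auto simp: power_graph_def)
    let ?X = "generate G {x}" and ?Y = "generate G {y}"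
    have X: "?X \<in> cyclic_subgroups G" and Y: "?Y \<in> cyclic_subgroups G"
      using x y by (auto simp: cyclic_subgroups_eq_image_generate)
    have fx: "f x \<in> pverts ?Q" and fy: "f y \<in> pverts ?Q"
      using img x y by blast+
    have "(x, y) \<in> parcs (power_graph G) \<longleftrightarrow> x \<noteq> y \<and> (?X \<subseteq> ?Y \<or> ?Y \<subseteq> ?X)"
      using x y assms(2) by (simp add: power_graph_def ex_nat_pow_iff_generate_subset)
    \<comment> \<open>Injectivity of \<open>f\<close> allows the inequality to be split by
      components. If \<open>?X = ?Y\<close>, nesting is automatic and only distinct numbers remain,
      which is adjacency in the complete graph.\<close>
    also have "\<dots> \<longleftrightarrow> f x \<noteq> f y \<and> (?X \<subseteq> ?Y \<or> ?Y \<subseteq> ?X)"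
      using inj x y by (simp add: inj_on_eq_iff)
    also have "\<dots> \<longleftrightarrow> ?X \<noteq> ?Y \<and> (?X \<subseteq> ?Y \<or> ?Y \<subseteq> ?X) \<or> ?X = ?Y \<and> h ?X x \<noteq> h ?Y y"
      by (auto simp: f_def)
    also have "\<dots> \<longleftrightarrow> (f x, f y) \<in> parcs ?Q"
      using fx fy X Y unfolding vertsQ
      by (auto simp: f_def gen_lex_product_def inclusion_graph_def cyclic_complete_family_def
          complete_graph_def)
    finally show "(x, y) \<in> parcs (power_graph G) \<longleftrightarrow> (f x, f y) \<in> parcs ?Q" .
  qed
qed

end
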